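(* Assume that $\phi$ is Lipschitz continuous on the range space of $F'(x)$, $R_\phi:=\operatorname{range}F'(x)$, for all $x\in\mathbf{R}^n$, with a global constant $L_\phi>0$, i.e. $|\phi(u)-\phi(v)|\le L_\phi\|u-v\|$ for all $u,v\in R_\phi$. Assume that $F$ is Lipschitz continuously differentiable with constant $L_F$, i.e. $\|F'(x)-F'(y)\|\le L_F\|y-x\|$ for all $x,y\in\mathcal F$. Assume also that $\mathcal F$ is sufficiently large that $\mathcal L_f(f(x^0))\subset\mathcal F$. Let $\{x^k\}_{k\ge0}$ be generated by Algorithm 1 (described in the context). Then for any $k\ge0$: (a) If $g$ is Lipschitz continuously differentiable with constant $L_g>0$ on $\operatorname{dom}(g)$, i.e. $\|\nabla g(x)-\nabla g(y)\|\le L_g\|y-x\|$ for all $x,y\in\operatorname{dom}(g)$, then (for the first version of Algorithm 1, with $\bar L:=L_g+L_\phi L_F$) $$f(x^k)-f^*\ \ge\ \frac{L_0}{2}\sum_{i=k}^{\infty}r_{\rho_i}(x^i)^2\ \ge\ \frac{L_0}{2}\sum_{i=k}^{\infty}r_{2\bar L}(x^i)^2 .$$ (b) If $g$ is proper, lower semicontinuous and convex on its domain, then (for the second version of Algorithm 1, with $\hat L:=L_\phi L_F$) $$f(x^k)-f^*\ \ge\ \frac{L_0}{2}\sum_{i=k}^{\infty}\tilde r_{\rho_i}(x^i)^2\ \ge\ \frac{L_0}{2}\sum_{i=k}^{\infty}\tilde r_{2\hat L}(x^i)^2 .$$ Consequently, $\lim_{k\to\infty}\|x^{k+1}-x^k\|=0$,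 and the set $Q^*$ of limit points of the sequence $\{x^k\}_{k\ge 0}$ is connected. If this sequence is bounded (in particular, if $\mathcal L_f(f(x^0))$ is bounded), then every limit point is a critical point of the problem $\min_{x\in\Omega}f(x)$. Furthermore, if the set of limit points $Q^*$ is finite, then the sequence $\{x^k\}$ converges to a point $x^*$ in $S^*$.
   Context: All norms are Euclidean (operator norm for matrices). $\Omega\subset\mathbf{R}^n$ is nonempty, closed and convex; $g:\mathbf{R}^n\to\mathbf{R}$; $F:\mathbf{R}^n\to\mathbf{R}^m$ is continuously differentiable on an open set $\mathcal F\subset\mathbf{R}^n$, with Jacobian $F'(x)$; $\phi:\mathbf{R}^m\to\mathbf{R}$ is proper, lower semicontinuous and convex. The objective is $f(x):=g(x)+\phi(F(x))$ and the problem is $\min_{x\in\Omega}f(x)$; $f^*$ denotes its optimal value. The level set is $\mathcal L_f(\alpha):=\{y\in\Omega:f(y)\le\alpha\}$. For $x\in\Omega$ and $\rho>0$: First version: $\psi(y;x):=g(x)+\nabla g(x)^T(y-x)+\phi(F(x)+F'(x)(y-x))$; $V_\rho(x)$ is the unique minimizer over $y\in\Omega$ of $\psi(y;x)+\frac{\rho}{2}\|y-x\|^2$; $f_\rho(x)$ is the minimal value; $r_\rho(x):=\|V_\rho(x)-x\|$. Second version ($g$ convex): $\tilde\psi(y;x):=g(y)+\phi(F(x)+F'(x)(y-x))$; $\tilde V_\rho(x)$ is the unique minimizer over $y\in\Omega$ of $\tilde\psi(y;x)+\frac{\rho}{2}\|y-x\|^2$; $\tilde f_\rho(x)$ is the minimal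 value; $\tilde r_\rho(x):=\|\tilde V_\rho(x)-x\|$. Algorithm 1. Choose $x^0\in\Omega$ and fix $L_0\in(0,\bar L]$ (first version), respectively $L_0\in(0,\hat L]$ (second version). For $k=0,1,\dots$: find $\rho_k\in[L_0,2\bar L]$ such that $f(V_{\rho_k}(x^k))\le f_{\rho_k}(x^k)$ (first version), respectively $\rho_k\in[L_0,2\hat L]$ such that $f(\tilde V_{\rho_k}(x^k))\le\tilde f_{\rho_k}(x^k)$ (second version); set $x^{k+1}:=V_{\rho_k}(x^k)$, respectively $x^{k+1}:=\tilde V_{\rho_k}(x^k)$. A point $x^*\in\Omega$ is a critical (stationary) point if $0\in\partial g(x^* )+F'(x^* )^T\partial\phi(F(x^* ))+N_\Omega(x^* )$, where $\partial g(x^* )$ is the convex subdifferential if $g$ is proper, lower semicontinuous and convex, and is $\nabla g(x^* )$ if $g$ is differentiable, $\partial\phi$ is the convex subdifferential, and $N_\Omega(x^* )=\{w: w^T(y-x^* )\le0\ \forall y\in\Omega\}$ is the normal cone. $S^*$ denotes the set of critical points, assumed nonempty.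
   Formalization: The optimal value f* is assumed finite; connectedness of Q* is claimed only for bounded sequences; limit points are claimed critical only if the level set of f(x^0) is closed (automatic for F continuous on Ω); convergence for finite Q* needs Q* nonempty. The unguarded claims fail. *)

theory Defs
  imports "HOL-Analysis.Analysis"
begin

definition grad :: "(real^'n \<Rightarrow> real) \<Rightarrow> real^'n \<Rightarrow> real^'n" where
  "grad g x = (THE v. GDERIV g x :> v)"

definition lower_semicontinuous :: "('a::topological_space \<Rightarrow> real) \<Rightarrow> bool" where
  "lower_semicontinuous h \<longleftrightarrow> (\<forall>x. \<forall>e>0. \<forall>\<^sub>F y in nhds x. h x - e < h y)"

text \<open>On an open set, differentiability at every point together with continuity of the Jacobian.
  Outside the set, \<open>jacobian F (at x)\<close> is an unspecified matrix.\<close>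

definition C1_on :: "(real^'n) set \<Rightarrow> (real^'n \<Rightarrow> real^'m) \<Rightarrow> bool" where
  "C1_on U F \<longleftrightarrow> (\<forall>x\<in>U. F differentiable (at x)) \<and> continuous_on U (\<lambda>x. jacobian F (at x))"

definition objective ::
    "(real^'n \<Rightarrow> real) \<Rightarrow> (real^'m \<Rightarrow> real) \<Rightarrow> (real^'n \<Rightarrow> real^'m) \<Rightarrow> real^'n \<Rightarrow> real" where
  "objective g \<phi> F x = g x + \<phi> (F x)"

definition level_set :: "'a set \<Rightarrow> ('a \<Rightarrow> real) \<Rightarrow> real \<Rightarrow> 'a set" where
  "level_set \<Omega> f \<alpha> = {y\<in>\<Omega>. f y \<le> \<alpha>}"

text \<open>The two model functions.  The base point \<open>x\<close> comes first, so \<open>model1 g \<phi> F x y\<close>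
  is \<open>\<psi>(y;x)\<close>, and \<open>model2\<close> is the version that keeps \<open>g\<close> unlinearised.\<close>

definition model1 ::
    "(real^'n \<Rightarrow> real) \<Rightarrow> (real^'m \<Rightarrow> real) \<Rightarrow> (real^'n \<Rightarrow> real^'m) \<Rightarrow> real^'n \<Rightarrow> real^'n \<Rightarrow> real"
  where
  "model1 g \<phi> F x y = g x + grad g x \<bullet> (y - x) + \<phi> (F x + jacobian F (at x) *v (y - x))"

definition model2 ::
    "(real^'n \<Rightarrow> real) \<Rightarrow> (real^'m \<Rightarrow> real) \<Rightarrow> (real^'n \<Rightarrow> real^'m) \<Rightarrow> real^'n \<Rightarrow> real^'n \<Rightarrow> real"
  where
  "model2 g \<phi> F x y = g y + \<phi> (F x + jacobian F (at x) *v (y - x))"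

text \<open>For \<open>m = model1 g \<phi> F\<close> (resp.\ \<open>model2\<close>) the following give the minimizer
  \<open>V\<^sub>\<rho>(x)\<close>, the minimal value \<open>f\<^sub>\<rho>(x)\<close> and the step length \<open>r\<^sub>\<rho>(x)\<close>
  (resp.\ their tilde versions).\<close>

definition reg_model :: "(real^'n \<Rightarrow> real^'n \<Rightarrow> real) \<Rightarrow> real \<Rightarrow> real^'n \<Rightarrow> real^'n \<Rightarrow> real" where
  "reg_model m \<rho> x y = m x y + \<rho> / 2 * (norm (y - x))\<^sup>2"

definition step_point ::
    "(real^'n) set \<Rightarrow> (real^'n \<Rightarrow> real^'n \<Rightarrow> real) \<Rightarrow> real \<Rightarrow> real^'n \<Rightarrow> real^'n" where
  "step_point \<Omega> m \<rho> x = (THE y. is_arg_min (reg_model m \<rho> x) (\<lambda>y. y \<in> \<Omega>) y)"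

definition step_value ::
    "(real^'n) set \<Rightarrow> (real^'n \<Rightarrow> real^'n \<Rightarrow> real) \<Rightarrow> real \<Rightarrow> real^'n \<Rightarrow> real" where
  "step_value \<Omega> m \<rho> x = (INF y\<in>\<Omega>. reg_model m \<rho> x y)"

definition step_length ::
    "(real^'n) set \<Rightarrow> (real^'n \<Rightarrow> real^'n \<Rightarrow> real) \<Rightarrow> real \<Rightarrow> real^'n \<Rightarrow> real" where
  "step_length \<Omega> m \<rho> x = norm (step_point \<Omega> m \<rho> x - x)"

text \<open>\<open>x\<close> and \<open>\<rho>\<close> are the iterates and the regularisation parameters of a run of the
  algorithm; \<open>L\<close> is the bound \<open>L\<^sub>g + L\<^sub>\<phi> L\<^sub>F\<close> in the first version and
  \<open>L\<^sub>\<phi> L\<^sub>F\<close> in the second.\<close>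

definition algorithm_run ::
    "(real^'n) set \<Rightarrow> (real^'n \<Rightarrow> real) \<Rightarrow> (real^'n \<Rightarrow> real^'n \<Rightarrow> real) \<Rightarrow> real \<Rightarrow> real
      \<Rightarrow> (nat \<Rightarrow> real^'n) \<Rightarrow> (nat \<Rightarrow> real) \<Rightarrow> bool" where
  "algorithm_run \<Omega> f m L0 L x \<rho> \<longleftrightarrow>
     x 0 \<in> \<Omega> \<and> L0 \<in> {0<..L} \<and>
     (\<forall>k. \<rho> k \<in> {L0..2 * L} \<and>
          f (step_point \<Omega> m (\<rho> k) (x k)) \<le> step_value \<Omega> m (\<rho> k) (x k) \<and>
          x (Suc k) = step_point \<Omega> m (\<rho> k) (x k))"

definition convex_subdifferential :: "('a::real_inner \<Rightarrow> real) \<Rightarrow> 'a \<Rightarrow> 'a set" where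
  "convex_subdifferential h x = {v. \<forall>y. h x + v \<bullet> (y - x) \<le> h y}"

text \<open>When \<open>g\<close> is both convex and differentiable the two branches agree.\<close>

definition subdifferential :: "(real^'n \<Rightarrow> real) \<Rightarrow> real^'n \<Rightarrow> (real^'n) set" where
  "subdifferential g x =
     (if lower_semicontinuous g \<and> convex_on UNIV g then convex_subdifferential g x
      else {v. GDERIV g x :> v})"

definition normal_cone :: "'a::real_inner set \<Rightarrow> 'a \<Rightarrow> 'a set" where
  "normal_cone \<Omega> x = {w. \<forall>y\<in>\<Omega>. w \<bullet> (y - x) \<le> 0}"

text \<open>Differentiability of \<open>F\<close> at \<open>x\<close> is part of the notion, because \<open>F'(x)\<close> occurs in it.\<close>

definition critical_points ::
    "(real^'n) set \<Rightarrow> (real^'n \<Rightarrow> real) \<Rightarrow> (real^'m \<Rightarrow> real) \<Rightarrow> (real^'n \<Rightarrow> real^'m) \<Rightarrow> (real^'n) set"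
  where
  "critical_points \<Omega> g \<phi> F =
     {x\<in>\<Omega>. F differentiable (at x) \<and>
        (\<exists>u\<in>subdifferential g x. \<exists>v\<in>convex_subdifferential \<phi> (F x). \<exists>w\<in>normal_cone \<Omega> x.
           0 = u + transpose (jacobian F (at x)) *v v + w)}"

definition limit_points :: "(nat \<Rightarrow> 'a::topological_space) \<Rightarrow> 'a set" where
  "limit_points x = {l. \<exists>s. strict_mono s \<and> (x \<circ> s) \<longlonglongrightarrow> l}"

text \<open>The hypotheses on \<open>g\<close> in the two versions.  As \<open>g\<close> is real-valued on the whole space,
  its domain is the whole space and it is automatically proper.\<close>

definition smooth_with_constant :: "real \<Rightarrow> (real^'n \<Rightarrow> real) \<Rightarrow> bool" where
  "smooth_with_constant Lg g \<longleftrightarrow>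
     Lg > 0 \<and> (\<forall>x. g differentiable (at x)) \<and>
     (\<forall>x y. norm (grad g x - grad g y) \<le> Lg * norm (y - x))"

definition lsc_convex :: "('a::real_normed_vector \<Rightarrow> real) \<Rightarrow> bool" where
  "lsc_convex h \<longleftrightarrow> lower_semicontinuous h \<and> convex_on UNIV h"

end

theory Submission
  imports Defs
begin

text \<open>
  The models are convex, so their regularisations are strongly convex: the minimizer exists, and
  comparing it with the base point gives \<open>f x - f_\<rho> x \<ge> \<rho>/2 r_\<rho>(x)\<^sup>2\<close>.
  Telescoping this along the run yields the two sums, and \<open>r_\<rho>\<close> is antitone in \<open>\<rho>\<close>.
  For a sequence with vanishing steps, a gap between limit points would be crossed infinitely
  often, and compactness would produce a limit point inside the gap.  Finally, a limit point
  minimizes its own convex model, and its multipliers come from a single separating hyperplane.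
\<close>

text \<open>The descent estimates treat both versions at once: they use only that \<open>m\<close>
  is convex in its second argument and agrees with \<open>f\<close> at the base point. The
  acceptance test, \<open>f\<close> at the new iterate at most \<open>f_\<rho>\<close>, is what
  turns a decrease of the model into a decrease of \<open>f\<close>. All convex functions here are
  finite on the whole space, hence continuous. This gives minimizers, lets \<phi> pass to the limit,
  and lets perturbations move in every direction, so that the separating hyperplane cannot be
  vertical. The obstacle in the last step is the location of limit points: \<open>F\<close> is
  smooth only on \<open>\<F>\<close>, and it is closedness of the initial level set that keeps limit
  points there.\<close>

section \<open>Regularised convex models: minimizers and step lengths\<close>

lemma norm_sq_convex_combination:
  fixes a b :: "'a::real_inner"
  shows "(norm ((1 - t) *\<^sub>R a + t *\<^sub>R b))\<^sup>2
    = (1 - t) * (norm a)\<^sup>2 + t * (norm b)\<^sup>2 - t * (1 - t) * (norm (b - a))\<^sup>2"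
  unfolding power2_norm_eq_inner
  by (simp add: inner_add_left inner_add_right inner_diff_left inner_diff_right inner_commute[of b a]
      algebra_simps)

lemma reg_model_strongly_convex:
  assumes "convex_on UNIV (m x)" "0 \<le> t" "t \<le> 1"
  shows "reg_model m \<rho> x ((1 - t) *\<^sub>R a + t *\<^sub>R b)
    \<le> (1 - t) * reg_model m \<rho> x a + t * reg_model m \<rho> x b - \<rho> / 2 * (t * (1 - t) * (norm (b - a))\<^sup>2)"
proof -
  have "(1 - t) *\<^sub>R a + t *\<^sub>R b - x = (1 - t) *\<^sub>R (a - x) + t *\<^sub>R (b - x)"
    by (simp add: algebra_simps)
  then have "(norm ((1 - t) *\<^sub>R a + t *\<^sub>R b - x))\<^sup>2
      = (1 - t) * (norm (a - x))\<^sup>2 + t * (norm (b - x))\<^sup>2 - t * (1 - t) * (norm (b - a))\<^sup>2"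
    using norm_sq_convex_combination[of t "a - x" "b - x"] by simp
  then show ?thesis
    using convex_onD[OF assms(1,2,3), of a b]
    by (simp only: reg_model_def) (simp add: field_simps)
qed

lemma reg_model_growth:
  assumes m: "convex_on UNIV (m x)" and \<Omega>: "convex \<Omega>"
    and v: "is_arg_min (reg_model m \<rho> x) (\<lambda>y. y \<in> \<Omega>) v" and y: "y \<in> \<Omega>"
  shows "reg_model m \<rho> x v + \<rho> / 2 * (norm (y - v))\<^sup>2 \<le> reg_model m \<rho> x y"
proof -
  let ?h = "reg_model m \<rho> x" and ?c = "\<rho> / 2 * (norm (y - v))\<^sup>2"
  \<comment> \<open>Here \<open>s\<close> is the weight of the minimizer \<open>v\<close> on the
    segment from \<open>v\<close> to \<open>y\<close>. Cancelling \<open>t = 1 - s\<close> leaves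
    the factor \<open>s\<close>; the full constant is reached as \<open>s\<close> tends to
    1.\<close>
  have "s * ?c \<le> ?h y - ?h v" if s: "0 < s" "s < 1" for s
  proof -
    define t where "t = 1 - s"
    have t: "0 < t" "t < 1" "s = 1 - t" using s by (auto simp: t_def)
    have "(1 - t) *\<^sub>R v + t *\<^sub>R y \<in> \<Omega>"
      using \<Omega> v y t by (auto simp: convex_alt is_arg_min_def)
    then have "?h v \<le> ?h ((1 - t) *\<^sub>R v + t *\<^sub>R y)"
      using v by (simp add: is_arg_min_linorder)
    also have "\<dots> \<le> (1 - t) * ?h v + t * ?h y - \<rho> / 2 * (t * (1 - t) * (norm (y - v))\<^sup>2)"
      using reg_model_strongly_convex[of m x t] m t by simp
    finally have "t * (s * ?c) \<le> t * (?h y - ?h v)"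
      by (simp add: algebra_simps diff_divide_distrib t(3))
    then show ?thesis using t by simp
  qed
  then have "?c \<le> ?h y - ?h v"
    by (rule field_le_mult_one_interval)
  then show ?thesis by simp
qed

text \<open>A finite convex function falls at most linearly along rays, so the quadratic penalty
  wins and the search can be confined to a ball.\<close>

lemma reg_model_minimizer_exists:
  fixes x :: "real^'n"
  assumes m: "convex_on UNIV (m x)" and \<Omega>: "closed \<Omega>" and x: "x \<in> \<Omega>" and \<rho>: "\<rho> > 0"
  shows "\<exists>v. is_arg_min (reg_model m \<rho> x) (\<lambda>y. y \<in> \<Omega>) v"
proof -
  let ?h = "reg_model m \<rho> x"
  have cont: "continuous_on UNIV (m x)"
    using convex_on_continuous[OF open_UNIV m] .
  obtain z where z: "\<And>y. y \<in> cball x 1 \<Longrightarrow> m x z \<le> m x y"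
    using continuous_attains_inf[of "cball x 1" "m x"] continuous_on_subset[OF cont] by force
  define c where "c = m x x - m x z"
  \<comment> \<open>\<open>c\<close> bounds the drop of the model on the unit ball. By convexity
    along the ray, the drop at distance \<open>t > 1\<close> is at most \<open>t * c\<close>, which
    the penalty \<open>\<rho> / 2 * t\<^sup>2\<close> covers once
    \<open>t \<ge> 2 * c / \<rho>\<close>.\<close>
  define R where "R = max 1 (2 * c / \<rho>)"
  have far: "?h x \<le> ?h y" if y: "y \<notin> cball x R" for y
  proof -
    define t where "t = norm (y - x)"
    have t: "t > 1" "t > 2 * c / \<rho>"
      using y by (auto simp: R_def t_def dist_norm norm_minus_commute)
    define w where "w = (1 - 1/t) *\<^sub>R x + (1/t) *\<^sub>R y"
    have "w - x = (1/t) *\<^sub>R (y - x)"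
      by (simp add: w_def algebra_simps)
    then have "norm (w - x) = 1" using t by (simp flip: t_def)
    then have "m x z \<le> m x w"
      using z[of w] by (simp add: dist_norm norm_minus_commute)
    also have "\<dots> \<le> (1 - 1/t) * m x x + (1/t) * m x y"
      unfolding w_def using t by (intro convex_onD[OF m]) auto
    finally have "t * m x z \<le> t * ((1 - 1/t) * m x x + (1/t) * m x y)"
      using t by (intro mult_left_mono) auto
    also have "\<dots> = (t - 1) * m x x + m x y"
      using t by (simp add: field_simps)
    finally have 1: "m x x - t * c \<le> m x y"
      by (simp add: c_def algebra_simps)
    have "c \<le> \<rho> / 2 * t" using t \<rho> by (simp add: field_simps)
    then have "t * c \<le> t * (\<rho> / 2 * t)" using t by (intro mult_left_mono) auto
    then have "t * c \<le> \<rho> / 2 * t\<^sup>2" by (simp add: power2_eq_square algebra_simps)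
    with 1 show ?thesis by (simp add: reg_model_def flip: t_def)
  qed
  have "continuous_on (\<Omega> \<inter> cball x R) ?h"
    unfolding reg_model_def by (intro continuous_intros continuous_on_subset[OF cont]) auto
  moreover have "compact (\<Omega> \<inter> cball x R)"
    using \<Omega> by (intro closed_Int_compact) auto
  moreover have xR: "x \<in> \<Omega> \<inter> cball x R"
    using x by (auto simp: R_def)
  ultimately obtain v where v: "v \<in> \<Omega> \<inter> cball x R" "\<And>y. y \<in> \<Omega> \<inter> cball x R \<Longrightarrow> ?h v \<le> ?h y"
    using continuous_attains_inf[of "\<Omega> \<inter> cball x R" ?h] by blast
  then have "?h v \<le> ?h y" if "y \<in> \<Omega>" for y
    using far[of y] v(2)[OF xR] that by (cases "y \<in> cball x R") force+
  then show ?thesis using v(1) by (auto simp: is_arg_min_linorder)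
qed

text \<open>This discharges the definite description in \<open>step_point\<close>: quadratic growth
  around one minimizer leaves no room for a second.\<close>

lemma step_point_is_arg_min:
  fixes x :: "real^'n"
  assumes "convex_on UNIV (m x)" "closed \<Omega>" "convex \<Omega>" "x \<in> \<Omega>" "\<rho> > 0"
  shows "is_arg_min (reg_model m \<rho> x) (\<lambda>y. y \<in> \<Omega>) (step_point \<Omega> m \<rho> x)"
proof -
  obtain v where v: "is_arg_min (reg_model m \<rho> x) (\<lambda>y. y \<in> \<Omega>) v"
    using reg_model_minimizer_exists[of m x] assms by blast
  have "w = v" if w: "is_arg_min (reg_model m \<rho> x) (\<lambda>y. y \<in> \<Omega>) w" for w
  proof -
    have "w \<in> \<Omega>" "reg_model m \<rho> x w \<le> reg_model m \<rho> x v"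
      using v w by (auto simp: is_arg_min_linorder)
    with reg_model_growth[OF assms(1,3) v, of w] have "\<rho> / 2 * (norm (w - v))\<^sup>2 \<le> 0"
      by linarith
    then show ?thesis using assms(5) by (simp add: mult_le_0_iff)
  qed
  then have "step_point \<Omega> m \<rho> x = v"
    unfolding step_point_def using v by blast
  with v show ?thesis by simp
qed

lemma step_value_eq:
  assumes "is_arg_min (reg_model m \<rho> x) (\<lambda>y. y \<in> \<Omega>) (step_point \<Omega> m \<rho> x)"
  shows "step_value \<Omega> m \<rho> x = reg_model m \<rho> x (step_point \<Omega> m \<rho> x)"
  unfolding step_value_def using assms
  by (intro cInf_eq_minimum) (auto simp: is_arg_min_linorder)

text \<open>Each minimizer is tested against the other. Adding the two inequalities cancels the
  model values and leaves \<open>\<sigma> - \<rho>\<close> times a comparison of the squared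
  lengths.\<close>

lemma step_length_antimono:
  fixes x :: "real^'n"
  assumes m: "convex_on UNIV (m x)" and \<Omega>: "closed \<Omega>" "convex \<Omega>" "x \<in> \<Omega>"
    and \<rho>: "0 < \<rho>" "\<rho> \<le> \<sigma>"
  shows "step_length \<Omega> m \<sigma> x \<le> step_length \<Omega> m \<rho> x"
proof (cases "\<rho> = \<sigma>")
  case False
  let ?v = "step_point \<Omega> m \<rho> x" and ?w = "step_point \<Omega> m \<sigma> x"
  have "is_arg_min (reg_model m \<rho> x) (\<lambda>y. y \<in> \<Omega>) ?v"
       "is_arg_min (reg_model m \<sigma> x) (\<lambda>y. y \<in> \<Omega>) ?w"
    using step_point_is_arg_min[of m x] assms by auto
  then have "reg_model m \<rho> x ?v \<le> reg_model m \<rho> x ?w" "reg_model m \<sigma> x ?w \<le> reg_model m \<sigma> x ?v"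
    by (auto simp: is_arg_min_linorder)
  then have "(\<sigma> - \<rho>) * (norm (?w - x))\<^sup>2 \<le> (\<sigma> - \<rho>) * (norm (?v - x))\<^sup>2"
    by (simp add: reg_model_def algebra_simps)
  then have "(norm (?w - x))\<^sup>2 \<le> (norm (?v - x))\<^sup>2"
    using False \<rho> by simp
  then show ?thesis by (simp add: step_length_def)
qed simp

section \<open>Descent and summability along a run\<close>

lemma algorithm_run_descent:
  fixes x :: "nat \<Rightarrow> real^'n"
  assumes run: "algorithm_run \<Omega> f m L0 L x \<rho>"
    and m: "\<And>y. convex_on UNIV (m y)" "\<And>y. m y y = f y"
    and \<Omega>: "closed \<Omega>" "convex \<Omega>"
  shows "x k \<in> \<Omega>"
    and "is_arg_min (reg_model m (\<rho> k) (x k)) (\<lambda>y. y \<in> \<Omega>) (x (Suc k))"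
    and "f (x (Suc k)) + L0 / 2 * (step_length \<Omega> m (\<rho> k) (x k))\<^sup>2 \<le> f (x k)"
    and "step_length \<Omega> m (2 * L) (x k) \<le> step_length \<Omega> m (\<rho> k) (x k)"
proof -
  have \<rho>: "\<rho> j > 0" "L0 \<le> \<rho> j" "\<rho> j \<le> 2 * L" "x (Suc j) = step_point \<Omega> m (\<rho> j) (x j)"
    "f (x (Suc j)) \<le> step_value \<Omega> m (\<rho> j) (x j)" for j
    using run by (auto simp: algorithm_run_def intro: less_le_trans)
  have arg: "is_arg_min (reg_model m (\<rho> j) (x j)) (\<lambda>y. y \<in> \<Omega>) (x (Suc j))" if "x j \<in> \<Omega>" for j
    using step_point_is_arg_min[of m "x j" \<Omega> "\<rho> j"] m \<Omega> that \<rho> by simp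
  have mem: "x j \<in> \<Omega>" for j
  proof (induction j)
    case 0
    then show ?case using run by (simp add: algorithm_run_def)
  next
    case (Suc j)
    then show ?case using arg by (simp add: is_arg_min_def)
  qed
  show "x k \<in> \<Omega>" by (rule mem)
  show arg': "is_arg_min (reg_model m (\<rho> k) (x k)) (\<lambda>y. y \<in> \<Omega>) (x (Suc k))"
    by (rule arg[OF mem])
  show "step_length \<Omega> m (2 * L) (x k) \<le> step_length \<Omega> m (\<rho> k) (x k)"
    using step_length_antimono[of m "x k"] m \<Omega> mem \<rho> by blast
  have "f (x (Suc k)) \<le> reg_model m (\<rho> k) (x k) (x (Suc k))"
    using step_value_eq[of m "\<rho> k" "x k" \<Omega>] \<rho>(4,5)[of k] arg' by simp
  \<comment> \<open>The base point is the competitor: its penalty vanishes and its model value is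
    \<open>f (x k)\<close>.\<close>
  moreover have "reg_model m (\<rho> k) (x k) (x (Suc k)) + \<rho> k / 2 * (norm (x k - x (Suc k)))\<^sup>2 \<le> f (x k)"
    using reg_model_growth[OF m(1) \<Omega>(2) arg' mem[of k]] m(2) by (simp add: reg_model_def)
  moreover have "L0 / 2 * (step_length \<Omega> m (\<rho> k) (x k))\<^sup>2 \<le> \<rho> k / 2 * (norm (x k - x (Suc k)))\<^sup>2"
    using \<rho>(2,4)[of k] by (auto simp: step_length_def norm_minus_commute intro!: mult_right_mono)
  ultimately show "f (x (Suc k)) + L0 / 2 * (step_length \<Omega> m (\<rho> k) (x k))\<^sup>2 \<le> f (x k)"
    by linarith
qed

lemma algorithm_run_in_level_set:
  fixes x :: "nat \<Rightarrow> real^'n"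
  assumes run: "algorithm_run \<Omega> f m L0 L x \<rho>"
    and m: "\<And>y. convex_on UNIV (m y)" "\<And>y. m y y = f y"
    and \<Omega>: "closed \<Omega>" "convex \<Omega>"
  shows "x k \<in> level_set \<Omega> f (f (x 0))"
proof -
  note D = algorithm_run_descent[OF run m \<Omega>]
  have "L0 > 0" using run by (simp add: algorithm_run_def)
  then have "f (x (Suc j)) \<le> f (x j)" for j
    using D(3)[of j] by (smt (verit) half_gt_zero mult_nonneg_nonneg zero_le_power2)
  then have "decseq (\<lambda>j. f (x j))" by (intro decseq_SucI)
  then show ?thesis using D(1) by (auto simp: level_set_def decseq_def)
qed

lemma telescoping_descent:
  fixes a d :: "nat \<Rightarrow> real"
  assumes d: "\<And>k. 0 \<le> d k" and step: "\<And>k. a (Suc k) + d k \<le> a k" and low: "\<And>k. b \<le> a k"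
  shows "summable (\<lambda>i. d (k + i))" "(\<Sum>i. d (k + i)) \<le> a k - b"
proof -
  have "a (k + n) + (\<Sum>i<n. d (k + i)) \<le> a k" for n
  proof (induction n)
    case (Suc n)
    then show ?case using step[of "k + n"] by simp
  qed simp
  then have *: "(\<Sum>i<n. d (k + i)) \<le> a k - b" for n
    using low[of "k + n"] by (smt (verit))
  show "summable (\<lambda>i. d (k + i))"
    using * d by (intro summableI_nonneg_bounded[where x = "a k - b"])
  then show "(\<Sum>i. d (k + i)) \<le> a k - b"
    using * by (intro suminf_le_const)
qed

lemma algorithm_run_summable:
  fixes x :: "nat \<Rightarrow> real^'n"
  assumes run: "algorithm_run \<Omega> f m L0 L x \<rho>"
    and m: "\<And>y. convex_on UNIV (m y)" "\<And>y. m y y = f y"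
    and \<Omega>: "closed \<Omega>" "convex \<Omega>" and bdd: "bdd_below (f ` \<Omega>)"
  defines "r \<equiv> step_length \<Omega> m"
  shows "summable (\<lambda>i. (r (\<rho> (k + i)) (x (k + i)))\<^sup>2)" (is ?A)
    and "summable (\<lambda>i. (r (2 * L) (x (k + i)))\<^sup>2)" (is ?B)
    and "f (x k) - (INF y\<in>\<Omega>. f y) \<ge> L0 / 2 * (\<Sum>i. (r (\<rho> (k + i)) (x (k + i)))\<^sup>2)"
    and "L0 / 2 * (\<Sum>i. (r (\<rho> (k + i)) (x (k + i)))\<^sup>2)
      \<ge> L0 / 2 * (\<Sum>i. (r (2 * L) (x (k + i)))\<^sup>2)"
    and "(\<lambda>k. norm (x (Suc k) - x k)) \<longlonglongrightarrow> 0"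
proof -
  note D = algorithm_run_descent[OF run m \<Omega>, folded r_def]
  have L0: "L0 > 0" using run by (simp add: algorithm_run_def)
  have low: "(INF y\<in>\<Omega>. f y) \<le> f (x j)" for j
    using D(1) bdd by (intro cINF_lower)
  note T = telescoping_descent[of "\<lambda>j. L0 / 2 * (r (\<rho> j) (x j))\<^sup>2" "\<lambda>j. f (x j)", OF _ D(3) low]
  have S: "summable (\<lambda>i. (r (\<rho> (j + i)) (x (j + i)))\<^sup>2)" for j
    using T(1)[of j] L0 by (simp add: summable_cmult_iff)
  then show ?A .
  have le: "(r (2 * L) (x j))\<^sup>2 \<le> (r (\<rho> j) (x j))\<^sup>2" for j
    using D(4)[of j] by (intro power_mono) (auto simp: r_def step_length_def)
  show B: ?B
    by (rule summable_comparison_test'[OF S[of k], of 0]) (use le in auto)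
  show "f (x k) - (INF y\<in>\<Omega>. f y) \<ge> L0 / 2 * (\<Sum>i. (r (\<rho> (k + i)) (x (k + i)))\<^sup>2)"
    using T(2)[of k] L0 suminf_mult[OF S[of k], of "L0 / 2"] by simp
  show "L0 / 2 * (\<Sum>i. (r (\<rho> (k + i)) (x (k + i)))\<^sup>2)
      \<ge> L0 / 2 * (\<Sum>i. (r (2 * L) (x (k + i)))\<^sup>2)"
    using L0 suminf_le[OF le B S] by (intro mult_left_mono) auto
  \<comment> \<open>The step length is the actual displacement of the iterate, so square summability
    yields vanishing steps.\<close>
  have "r (\<rho> j) (x j) = norm (x (Suc j) - x j)" for j
    using run by (simp add: r_def step_length_def algorithm_run_def)
  then have "(\<lambda>j. (norm (x (Suc j) - x j))\<^sup>2) \<longlonglongrightarrow> 0"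
    using summable_LIMSEQ_zero[OF S[of 0]] by simp
  then show "(\<lambda>k. norm (x (Suc k) - x k)) \<longlonglongrightarrow> 0"
    using tendsto_real_sqrt by fastforce
qed

section \<open>Limit points of sequences with vanishing steps\<close>

lemma limit_points_imp_frequently:
  assumes "l \<in> limit_points x" "open U" "l \<in> U"
  shows "\<exists>\<^sub>F k in sequentially. x k \<in> U"
proof -
  obtain s where s: "strict_mono s" "(x \<circ> s) \<longlonglongrightarrow> l"
    using assms(1) by (auto simp: limit_points_def)
  then have "\<forall>\<^sub>F n in sequentially. x (s n) \<in> U"
    using topological_tendstoD[OF s(2) assms(2,3)] by simp
  then obtain N where N: "\<And>n. n \<ge> N \<Longrightarrow> x (s n) \<in> U"
    by (auto simp: eventually_sequentially)
  have "\<exists>k\<ge>M. x k \<in> U" for M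
    using N[of "max N M"] seq_suble[OF s(1), of "max N M"] by (intro exI[of _ "s (max N M)"]) auto
  then show ?thesis by (simp add: frequently_sequentially)
qed

text \<open>The source of contradictions below: a compact region visited infinitely often, yet free
  of limit points, is impossible.\<close>

lemma frequently_in_compact_limit_point:
  fixes x :: "nat \<Rightarrow> 'a::metric_space"
  assumes K: "compact K" and fr: "\<exists>\<^sub>F k in sequentially. x k \<in> K"
  shows "\<exists>l\<in>K. l \<in> limit_points x"
proof -
  obtain r :: "nat \<Rightarrow> nat" where r: "strict_mono r" "\<And>n. x (r n) \<in> K"
    using not_eventually_sequentiallyD[of "\<lambda>k. x k \<notin> K"] fr
    by (auto simp: frequently_def)
  have "\<forall>n. (x \<circ> r) n \<in> K" using r by simp
  then obtain l s where "l \<in> K" "strict_mono s" "((x \<circ> r) \<circ> s) \<longlonglongrightarrow> l"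
    using K unfolding compact_eq_seq_compact_metric seq_compact_def by blast
  moreover have "strict_mono (r \<circ> s)" using r(1) \<open>strict_mono s\<close> by (rule strict_mono_o)
  ultimately show ?thesis
    unfolding limit_points_def by (auto simp: comp_assoc)
qed

lemma closed_limit_points:
  fixes x :: "nat \<Rightarrow> 'a::metric_space"
  shows "closed (limit_points x)"
proof -
  have "l \<in> limit_points x" if l: "l \<in> closure (limit_points x)" for l
  proof -
    \<comment> \<open>The strict bound \<open>k > M\<close> is what allows the indices chosen below
      to increase strictly.\<close>
    have near: "\<exists>k>M. dist (x k) l < e" if "e > 0" for M e
    proof -
      obtain q where q: "q \<in> limit_points x" "dist q l < e"
        using l \<open>e > 0\<close> closure_approachable by blast
      have "\<exists>\<^sub>F k in sequentially. x k \<in> ball l e"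
        using q by (intro limit_points_imp_frequently) (auto simp: dist_commute)
      then obtain k where "k \<ge> Suc M" "x k \<in> ball l e"
        unfolding frequently_sequentially by blast
      then show ?thesis
        by (auto simp: dist_commute Suc_le_eq)
    qed
    have "\<exists>s. \<forall>n. dist (x (s n)) l < 1 / real (Suc n) \<and> s n < s (Suc n)"
    proof (rule dependent_nat_choice)
      show "\<exists>k. dist (x k) l < 1 / real (Suc 0)"
        using near[of 1 0] by auto
      show "\<exists>k'. dist (x k') l < 1 / real (Suc (Suc n)) \<and> k < k'" for k n
        using near[of "1 / real (Suc (Suc n))" k] by auto
    qed
    then obtain s where s: "\<And>n. dist (x (s n)) l < 1 / real (Suc n)" "\<And>n. s n < s (Suc n)"
      by blast
    have "(\<lambda>n. dist (x (s n)) l) \<longlonglongrightarrow> 0"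
      by (rule tendsto_sandwich[OF _ _ tendsto_const LIMSEQ_inverse_real_of_nat])
        (use s(1) in \<open>auto simp: inverse_eq_divide intro!: always_eventually less_imp_le\<close>)
    then have "(x \<circ> s) \<longlonglongrightarrow> l"
      unfolding o_def by (rule tendsto_dist_iff[THEN iffD2])
    then show ?thesis using s(2) by (auto simp: limit_points_def strict_mono_Suc_iff)
  qed
  then show ?thesis using closure_subset_eq by blast
qed

text \<open>A discrete intermediate value theorem: once the increments are smaller than the width of
  the band, an upward crossing cannot jump over it.\<close>

lemma frequently_in_band:
  fixes u :: "nat \<Rightarrow> real"
  assumes steps: "(\<lambda>k. u (Suc k) - u k) \<longlonglongrightarrow> 0" and ab: "a < b"
    and below: "\<exists>\<^sub>F k in sequentially. u k < a" and above: "\<exists>\<^sub>F k in sequentially. a \<le> u k"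
  shows "\<exists>\<^sub>F k in sequentially. a \<le> u k \<and> u k \<le> b"
  unfolding frequently_sequentially
proof
  fix N
  have "\<forall>\<^sub>F k in sequentially. u (Suc k) - u k < b - a"
    using order_tendstoD(2)[OF steps, of "b - a"] ab by simp
  then obtain N0 where N0: "\<And>k. k \<ge> N0 \<Longrightarrow> u (Suc k) - u k < b - a"
    by (auto simp: eventually_sequentially)
  obtain k where k: "k \<ge> max N N0" "u k < a"
    using below unfolding frequently_sequentially by blast
  obtain j where "j \<ge> k" "a \<le> u j"
    using above unfolding frequently_sequentially by blast
  then have ex: "\<exists>n. a \<le> u (k + n)" by (metis le_Suc_ex)
  \<comment> \<open>The first upcrossing after \<open>k\<close>. It is not at \<open>k\<close>
    itself, so its predecessor lies below \<open>a\<close> and one short step ends below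
    \<open>b\<close>.\<close>
  define n where "n = (LEAST n. a \<le> u (k + n))"
  have n: "a \<le> u (k + n)" using LeastI_ex[OF ex] by (simp add: n_def)
  have "n \<noteq> 0"
  proof
    assume "n = 0"
    with n k show False by simp
  qed
  then obtain p where p: "n = Suc p" by (cases n) auto
  have "u (k + p) < a"
    using not_less_Least[of p "\<lambda>n. a \<le> u (k + n)"] p by (simp add: n_def)
  then have "u (k + n) \<le> b"
    using N0[of "k + p"] k p by simp
  with n k show "\<exists>k\<ge>N. a \<le> u k \<and> u k \<le> b"
    by (intro exI[of _ "k + n"]) auto
qed

lemma infdist_steps_tendsto_zero:
  fixes x :: "nat \<Rightarrow> 'a::real_normed_vector"
  assumes "(\<lambda>k. norm (x (Suc k) - x k)) \<longlonglongrightarrow> 0"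
  shows "(\<lambda>k. infdist (x (Suc k)) A - infdist (x k) A) \<longlonglongrightarrow> 0"
  by (rule Lim_null_comparison[OF _ assms])
    (use infdist_triangle_abs[of _ A] in \<open>auto simp: dist_norm intro!: always_eventually\<close>)

text \<open>Boundedness is used twice: it makes \<open>A\<close> compact, so that the gap
  \<open>d\<close> to \<open>B\<close> is positive, and it makes the part of the gap visited by the
  sequence compact.\<close>

lemma connected_limit_points:
  fixes x :: "nat \<Rightarrow> 'a::euclidean_space"
  assumes bdd: "bounded (range x)" and steps: "(\<lambda>k. norm (x (Suc k) - x k)) \<longlonglongrightarrow> 0"
  shows "connected (limit_points x)"
  unfolding connected_closed_set[OF closed_limit_points]
proof (rule notI, elim exE conjE)
  fix A B
  assume A: "closed A" "A \<noteq> {}" and B: "closed B" "B \<noteq> {}"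
    and AB: "A \<union> B = limit_points x" "A \<inter> B = {}"
  have cl: "limit_points x \<subseteq> closure (range x)"
  proof
    fix l
    assume "l \<in> limit_points x"
    then obtain s where "(x \<circ> s) \<longlonglongrightarrow> l" by (auto simp: limit_points_def)
    then show "l \<in> closure (range x)"
      unfolding closure_sequential by (intro exI[of _ "x \<circ> s"]) auto
  qed
  have "compact A"
    using A cl AB bounded_subset[OF bounded_closure[OF bdd], of A]
    unfolding compact_eq_bounded_closed by blast
  then obtain d where d: "d > 0" "\<And>a b. a \<in> A \<Longrightarrow> b \<in> B \<Longrightarrow> d \<le> dist a b"
    using separate_compact_closed[of A B] B AB by blast
  have far: "d \<le> infdist b A" if "b \<in> B" for b
    using A d(2) that by (auto simp: infdist_notempty dist_commute intro!: cINF_greatest)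
  define u where "u = (\<lambda>k. infdist (x k) A)"
  have op: "open {y. infdist y A < d / 3}" "open {y. d / 3 < infdist y A}"
    by (intro open_Collect_less continuous_intros)+
  obtain a b where ab: "a \<in> A" "b \<in> B" using A B by blast
  have "\<exists>\<^sub>F k in sequentially. x k \<in> {y. infdist y A < d / 3}"
    using ab d AB op by (intro limit_points_imp_frequently[of a]) auto
  then have "\<exists>\<^sub>F k in sequentially. u k < d / 3" by (simp add: u_def)
  moreover have "\<exists>\<^sub>F k in sequentially. x k \<in> {y. d / 3 < infdist y A}"
    using ab d AB op far[of b] by (intro limit_points_imp_frequently[of b]) auto
  then have "\<exists>\<^sub>F k in sequentially. d / 3 \<le> u k"
    by (rule frequently_elim1) (simp add: u_def)
  moreover have "(\<lambda>k. u (Suc k) - u k) \<longlonglongrightarrow> 0"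
    unfolding u_def by (rule infdist_steps_tendsto_zero[OF steps])
  \<comment> \<open>The levels \<open>d / 3\<close> and \<open>d / 2\<close> are any two in
    \<open>(0, d)\<close>: a point between them is too far from \<open>A\<close> to be in
    \<open>A\<close> and too close to be in \<open>B\<close>.\<close>
  ultimately have "\<exists>\<^sub>F k in sequentially. d / 3 \<le> u k \<and> u k \<le> d / 2"
    using d by (intro frequently_in_band) auto
  then have fr: "\<exists>\<^sub>F k in sequentially. x k \<in> closure (range x) \<inter> {y. d / 3 \<le> infdist y A \<and> infdist y A \<le> d / 2}"
    using closure_subset[of "range x"] by (elim frequently_elim1) (auto simp: u_def)
  have "closed {y. d / 3 \<le> infdist y A \<and> infdist y A \<le> d / 2}"
    by (intro closed_Collect_conj closed_Collect_le continuous_intros)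
  then have "compact (closure (range x) \<inter> {y. d / 3 \<le> infdist y A \<and> infdist y A \<le> d / 2})"
    using bdd by (intro compact_Int_closed) auto
  from frequently_in_compact_limit_point[OF this fr] obtain l
    where l: "l \<in> A \<union> B" "d / 3 \<le> infdist l A" "infdist l A \<le> d / 2"
    using AB by auto
  then show False using far[of l] d by auto
qed

text \<open>If the sequence left some ball around \<open>q\<close> infinitely often, it would cross
  a compact annulus containing no limit point. Only this annulus has to be compact, so the sequence
  may be unbounded a priori.\<close>

lemma isolated_limit_point_imp_convergent:
  fixes x :: "nat \<Rightarrow> 'a::euclidean_space"
  assumes fin: "finite (limit_points x)" and q: "q \<in> limit_points x"
    and steps: "(\<lambda>k. norm (x (Suc k) - x k)) \<longlonglongrightarrow> 0"
  shows "x \<longlonglongrightarrow> q"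
proof -
  obtain d where d: "d > 0" "\<And>l. l \<in> limit_points x \<Longrightarrow> l \<noteq> q \<Longrightarrow> d \<le> dist q l"
    using finite_set_avoid[OF fin, of q] by auto
  show ?thesis
  proof (rule tendstoI, rule ccontr)
    fix e :: real
    assume e: "e > 0" and "\<not> (\<forall>\<^sub>F k in sequentially. dist (x k) q < e)"
    then have above: "\<exists>\<^sub>F k in sequentially. e \<le> dist (x k) q"
      by (simp add: frequently_def not_le)
    \<comment> \<open>The bound \<open>e\<close> makes every escape from the \<open>e\<close>-ball
      an escape from the \<open>a\<close>-ball; \<open>d / 3\<close> keeps the annulus up to
      \<open>d / 2\<close> nondegenerate.\<close>
    define a where "a = min e (d / 3)"
    have a: "0 < a" "a < d / 2" "a \<le> e" using e d by (auto simp: a_def)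
    have "\<exists>\<^sub>F k in sequentially. x k \<in> ball q a"
      using q a by (intro limit_points_imp_frequently) auto
    then have "\<exists>\<^sub>F k in sequentially. infdist (x k) {q} < a"
      by (simp add: dist_commute)
    moreover have "\<exists>\<^sub>F k in sequentially. a \<le> infdist (x k) {q}"
      using above by (rule frequently_elim1) (use a in simp)
    ultimately have "\<exists>\<^sub>F k in sequentially. a \<le> infdist (x k) {q} \<and> infdist (x k) {q} \<le> d / 2"
      using frequently_in_band[OF infdist_steps_tendsto_zero[OF steps]] a by blast
    then have fr: "\<exists>\<^sub>F k in sequentially. x k \<in> cball q (d / 2) - ball q a"
      by (elim frequently_elim1) (auto simp: dist_commute)
    have "compact (cball q (d / 2) - ball q a)" by (intro compact_diff) auto
    from frequently_in_compact_limit_point[OF this fr] obtain l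
      where "l \<in> limit_points x" "dist q l \<le> d / 2" "a \<le> dist q l" by auto
    then show False using d a by (cases "l = q") (auto, force)
  qed
qed

section \<open>Criticality of limit points\<close>

lemma convex_on_affine_compose:
  assumes \<phi>: "convex_on UNIV \<phi>" and A: "linear A"
  shows "convex_on UNIV (\<lambda>y. \<phi> (b + A (y - x)))"
proof (rule convex_onI)
  fix t :: real and y z
  assume t: "0 < t" "t < 1"
  interpret linear A by (rule A)
  have "b + A ((1 - t) *\<^sub>R y + t *\<^sub>R z - x) = (1 - t) *\<^sub>R (b + A (y - x)) + t *\<^sub>R (b + A (z - x))"
    by (simp add: add diff scale algebra_simps)
  then show "\<phi> (b + A ((1 - t) *\<^sub>R y + t *\<^sub>R z - x))
      \<le> (1 - t) * \<phi> (b + A (y - x)) + t * \<phi> (b + A (z - x))"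
    using convex_onD[OF \<phi>, of t "b + A (y - x)" "b + A (z - x)"] t by simp
qed simp

lemma convex_on_affine: "convex_on UNIV (\<lambda>y. c + a \<bullet> (y - x))"
  by (rule convex_onI) (auto simp: algebra_simps inner_add_right inner_diff_right)

text \<open>The perturbed value function
  \<open>(p, q) \<mapsto> inf {h (y + p) + \<phi> (b + A (y - x) + q) | y \<in> \<Omega>}\<close> is convex; a hyperplane
  supporting its strict epigraph at the origin yields all multipliers at once.\<close>

lemma composite_minimizer_multipliers:
  fixes h :: "'a::euclidean_space \<Rightarrow> real" and \<phi> :: "'b::euclidean_space \<Rightarrow> real"
  assumes h: "convex_on UNIV h" and \<phi>: "convex_on UNIV \<phi>" and A: "linear A"
    and \<Omega>: "convex \<Omega>" "x \<in> \<Omega>"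
    and min: "\<And>y. y \<in> \<Omega> \<Longrightarrow> h x + \<phi> b \<le> h y + \<phi> (b + A (y - x))"
  obtains \<alpha> \<beta> where "\<alpha> \<in> convex_subdifferential h x" "\<beta> \<in> convex_subdifferential \<phi> b"
    "\<And>y. y \<in> \<Omega> \<Longrightarrow> 0 \<le> \<alpha> \<bullet> (y - x) + \<beta> \<bullet> A (y - x)"
proof -
  interpret linear A by (rule A)
  \<comment> \<open>\<open>t\<close> is measured from the optimal value, so strictness of the
    inequality excludes the origin.\<close>
  define C where "C = {(p, q, t). \<exists>y\<in>\<Omega>. h (y + p) + \<phi> (b + A (y - x) + q) < h x + \<phi> b + t}"
  have "convex C"
  proof (rule convexI)
    fix c c' :: "'a \<times> 'b \<times> real" and u v :: real
    assume "c \<in> C" "c' \<in> C" and uv: "0 \<le> u" "0 \<le> v" "u + v = 1"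
    then obtain p q t y p' q' t' y' where
      c: "c = (p, q, t)" "y \<in> \<Omega>" "h (y + p) + \<phi> (b + A (y - x) + q) < h x + \<phi> b + t" and
      c': "c' = (p', q', t')" "y' \<in> \<Omega>" "h (y' + p') + \<phi> (b + A (y' - x) + q') < h x + \<phi> b + t'"
      unfolding C_def by blast
    define w where "w = u *\<^sub>R y + v *\<^sub>R y'"
    have v: "v = 1 - u" using uv by simp
    have "w + (u *\<^sub>R p + v *\<^sub>R p') = u *\<^sub>R (y + p) + v *\<^sub>R (y' + p')"
      by (simp add: w_def algebra_simps)
    then have 1: "h (w + (u *\<^sub>R p + v *\<^sub>R p')) \<le> u * h (y + p) + v * h (y' + p')"
      using h uv by (auto simp: convex_on_def)
    have "b + A (w - x) + (u *\<^sub>R q + v *\<^sub>R q')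
        = u *\<^sub>R (b + A (y - x) + q) + v *\<^sub>R (b + A (y' - x) + q')"
      by (simp add: w_def v add diff scale algebra_simps)
    then have 2: "\<phi> (b + A (w - x) + (u *\<^sub>R q + v *\<^sub>R q'))
        \<le> u * \<phi> (b + A (y - x) + q) + v * \<phi> (b + A (y' - x) + q')"
      using \<phi> uv by (auto simp: convex_on_def)
    \<comment> \<open>Strictness survives only through a term of positive weight, hence the split on
      \<open>u = 0\<close>, where \<open>v = 1\<close>.\<close>
    have "u * (h (y + p) + \<phi> (b + A (y - x) + q)) + v * (h (y' + p') + \<phi> (b + A (y' - x) + q'))
        < u * (h x + \<phi> b + t) + v * (h x + \<phi> b + t')"
    proof (cases "u = 0")
      case True
      then show ?thesis using c' uv by simp
    next
      case False
      have "u * (h (y + p) + \<phi> (b + A (y - x) + q)) < u * (h x + \<phi> b + t)"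
        by (rule mult_strict_left_mono) (use c False uv in auto)
      moreover have "v * (h (y' + p') + \<phi> (b + A (y' - x) + q')) \<le> v * (h x + \<phi> b + t')"
        by (rule mult_left_mono) (use c' uv in auto)
      ultimately show ?thesis by linarith
    qed
    also have "\<dots> = h x + \<phi> b + (u * t + v * t')"
      by (simp add: v algebra_simps)
    finally have "h (w + (u *\<^sub>R p + v *\<^sub>R p')) + \<phi> (b + A (w - x) + (u *\<^sub>R q + v *\<^sub>R q'))
        < h x + \<phi> b + (u * t + v * t')"
      using 1 2 by (simp add: algebra_simps)
    moreover have "w \<in> \<Omega>" using \<Omega> c c' uv by (simp add: w_def convexD)
    ultimately show "u *\<^sub>R c + v *\<^sub>R c' \<in> C"
      unfolding C_def c c' by auto
  qed
  moreover have "0 \<notin> C"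
    using min by (auto simp: C_def zero_prod_def not_less)
  ultimately obtain a where a: "a \<noteq> 0" "\<And>c. c \<in> C \<Longrightarrow> 0 \<le> a \<bullet> c"
    using separating_hyperplane_set_0[of C] by auto
  obtain \<alpha>0 \<beta>0 \<tau> where a_eq: "a = (\<alpha>0, \<beta>0, \<tau>)" by (cases a)
  \<comment> \<open>The substitution \<open>y' = y + p\<close>, \<open>z = b + A (y - x) + q\<close>
    decouples the arguments of \<open>h\<close>, \<phi> and the constraint.\<close>
  have key: "0 \<le> \<alpha>0 \<bullet> (y' - y) + \<beta>0 \<bullet> (z - b - A (y - x)) + \<tau> * t"
    if "y \<in> \<Omega>" "h y' + \<phi> z < h x + \<phi> b + t" for y y' z t
  proof -
    have "(y' - y, z - b - A (y - x), t) \<in> C"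
      unfolding C_def using that by (auto intro!: bexI[of _ y])
    from a(2)[OF this] show ?thesis by (simp add: a_eq inner_Pair)
  qed
  have "\<tau> \<ge> 0"
    using key[of x x b 1] \<Omega> by simp
  \<comment> \<open>With \<open>\<tau> = 0\<close>, shifting by \<open>- \<alpha>0\<close> and
    \<open>- \<beta>0\<close> is admissible for large \<open>t\<close>, as \<open>h\<close> and
    \<phi> are finite there; both multipliers would vanish.\<close>
  moreover have "\<tau> \<noteq> 0"
  proof
    assume \<tau>: "\<tau> = 0"
    have "0 \<le> - (\<alpha>0 \<bullet> \<alpha>0) - \<beta>0 \<bullet> \<beta>0"
      using key[of x "x - \<alpha>0" "b - \<beta>0" "h (x - \<alpha>0) + \<phi> (b - \<beta>0) - h x - \<phi> b + 1"] \<Omega> \<tau>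
      by simp
    then have "\<alpha>0 \<bullet> \<alpha>0 = 0" "\<beta>0 \<bullet> \<beta>0 = 0"
      using inner_ge_zero[of \<alpha>0] inner_ge_zero[of \<beta>0] by linarith+
    then show False using a(1) \<tau> by (simp add: a_eq zero_prod_def)
  qed
  ultimately have \<tau>: "\<tau> > 0" by simp
  define \<alpha> \<beta> where "\<alpha> = (- 1 / \<tau>) *\<^sub>R \<alpha>0" and "\<beta> = (- 1 / \<tau>) *\<^sub>R \<beta>0"
  have main: "\<alpha> \<bullet> (y' - y) + \<beta> \<bullet> (z - b - A (y - x)) \<le> h y' + \<phi> z - h x - \<phi> b"
    if y: "y \<in> \<Omega>" for y y' z
  proof (rule field_le_epsilon)
    fix e :: real
    assume e: "e > 0"
    have "0 \<le> \<alpha>0 \<bullet> (y' - y) + \<beta>0 \<bullet> (z - b - A (y - x)) + \<tau> * (h y' + \<phi> z - h x - \<phi> b + e)"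
      by (rule key) (use y e in auto)
    then show "\<alpha> \<bullet> (y' - y) + \<beta> \<bullet> (z - b - A (y - x)) \<le> h y' + \<phi> z - h x - \<phi> b + e"
      using \<tau> by (simp add: \<alpha>_def \<beta>_def field_simps)
  qed
  \<comment> \<open>Freezing two of the three free points at their base values isolates in turn
    \<open>h\<close>, \<phi> and the constraint.\<close>
  show ?thesis
  proof
    show "\<alpha> \<in> convex_subdifferential h x"
      using main[of x _ b] \<Omega> by (auto simp: convex_subdifferential_def algebra_simps)
    show "\<beta> \<in> convex_subdifferential \<phi> b"
      using main[of x x] \<Omega> by (auto simp: convex_subdifferential_def algebra_simps)
    show "0 \<le> \<alpha> \<bullet> (y - x) + \<beta> \<bullet> A (y - x)" if "y \<in> \<Omega>" for y
      using main[OF that, of x b] by (simp add: inner_diff_right)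
  qed
qed

lemma convex_subdifferential_affine:
  assumes "u \<in> convex_subdifferential (\<lambda>y. c + a \<bullet> (y - x)) x"
  shows "u = a"
proof -
  have "(u - a) \<bullet> (u - a) \<le> 0"
    using assms[unfolded convex_subdifferential_def, simplified, rule_format, of "x + (u - a)"]
    by (simp add: inner_diff_left)
  then show ?thesis by (metis inner_ge_zero inner_eq_zero_iff order_antisym right_minus_eq)
qed

text \<open>\<open>h\<close> is a convex stand-in for \<open>g\<close>: its linearisation at
  \<open>x\<close> or \<open>g\<close> itself. The normal vector is defined as the negative of the
  other two terms, and the joint multiplier inequality says that it is normal.\<close>

lemma critical_pointI:
  fixes \<Omega> :: "(real^'n) set" and F :: "real^'n \<Rightarrow> real^'m"
  assumes h: "convex_on UNIV h" and \<phi>: "convex_on UNIV \<phi>"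
    and \<Omega>: "convex \<Omega>" "x \<in> \<Omega>" and F: "F differentiable (at x)"
    and min: "\<And>y. y \<in> \<Omega> \<Longrightarrow> h x + \<phi> (F x) \<le> h y + \<phi> (F x + jacobian F (at x) *v (y - x))"
    and sub: "convex_subdifferential h x \<subseteq> subdifferential g x"
  shows "x \<in> critical_points \<Omega> g \<phi> F"
proof -
  let ?J = "jacobian F (at x)"
  obtain \<alpha> \<beta> where \<alpha>: "\<alpha> \<in> convex_subdifferential h x"
    and \<beta>: "\<beta> \<in> convex_subdifferential \<phi> (F x)"
    and ineq: "\<And>y. y \<in> \<Omega> \<Longrightarrow> 0 \<le> \<alpha> \<bullet> (y - x) + \<beta> \<bullet> (?J *v (y - x))"
    using composite_minimizer_multipliers[OF h \<phi> matrix_vector_mul_linear \<Omega> min] by metis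
  have "- (\<alpha> + transpose ?J *v \<beta>) \<bullet> (y - x) = - (\<alpha> \<bullet> (y - x) + \<beta> \<bullet> (?J *v (y - x)))" for y
    by (simp add: inner_diff_left dot_lmul_matrix)
  then have "- (\<alpha> + transpose ?J *v \<beta>) \<in> normal_cone \<Omega> x"
    using ineq by (simp only: normal_cone_def mem_Collect_eq neg_le_0_iff_le) blast
  then show ?thesis
    unfolding critical_points_def using \<alpha> \<beta> sub \<Omega>(2) F
    by (intro CollectI conjI bexI[of _ \<alpha>] bexI[of _ \<beta>] bexI[of _ "- (\<alpha> + transpose ?J *v \<beta>)"]) auto
qed

section \<open>Gradients and subgradients\<close>

lemma GDERIV_grad:
  fixes g :: "real^'n \<Rightarrow> real"
  assumes "g differentiable (at x)"
  shows "GDERIV g x :> grad g x"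
proof -
  obtain D where D: "(g has_derivative D) (at x)"
    using assms by (auto simp: differentiable_def)
  then interpret linear D by (rule has_derivative_linear)
  \<comment> \<open>\<open>adjoint D 1\<close> is the Riesz representative of the
    derivative.\<close>
  have "D = (\<lambda>h. h \<bullet> adjoint D 1)"
    using adjoint_works[OF linear_axioms, of _ 1] by (auto simp: inner_real_def)
  then have ex: "GDERIV g x :> adjoint D 1" using D by (simp add: gderiv_def)
  have "v = w" if "GDERIV g x :> v" "GDERIV g x :> w" for v w
  proof -
    have "(\<lambda>h. h \<bullet> v) = (\<lambda>h. h \<bullet> w)"
      using that unfolding gderiv_def by (rule has_derivative_unique)
    then have "(v - w) \<bullet> v = (v - w) \<bullet> w" by (rule fun_cong)
    then have "(v - w) \<bullet> (v - w) = 0" by (simp add: inner_diff_right)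
    then show ?thesis by simp
  qed
  then show ?thesis unfolding grad_def by (metis ex theI)
qed

text \<open>Restriction to the line through \<open>x\<close> and \<open>y\<close> reduces this to
  the tangent inequality in one variable.\<close>

lemma GDERIV_convex_subgradient:
  assumes g: "convex_on UNIV g" and v: "GDERIV g x :> v"
  shows "v \<in> convex_subdifferential g x"
proof -
  have "g x + v \<bullet> (y - x) \<le> g y" for y
  proof -
    define p where "p = (\<lambda>t::real. g (x + t *\<^sub>R (y - x)))"
    have "convex_on UNIV p"
    proof (rule convex_onI)
      fix t a b :: real
      assume t: "0 < t" "t < 1"
      have "x + ((1 - t) *\<^sub>R a + t *\<^sub>R b) *\<^sub>R (y - x)
          = (1 - t) *\<^sub>R (x + a *\<^sub>R (y - x)) + t *\<^sub>R (x + b *\<^sub>R (y - x))"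
        by (simp add: algebra_simps)
      then show "p ((1 - t) *\<^sub>R a + t *\<^sub>R b) \<le> (1 - t) * p a + t * p b"
        unfolding p_def using convex_onD[OF g, of t] t by simp
    qed simp
    moreover have "(p has_real_derivative v \<bullet> (y - x)) (at 0)"
    proof -
      have "((\<lambda>t::real. x + t *\<^sub>R (y - x)) has_derivative (\<lambda>t. t *\<^sub>R (y - x))) (at 0)"
        by (auto intro!: derivative_eq_intros)
      moreover have "(g has_derivative (\<lambda>h. h \<bullet> v)) (at (x + 0 *\<^sub>R (y - x)))"
        using v by (simp add: gderiv_def)
      ultimately have "(p has_derivative (\<lambda>t. (t *\<^sub>R (y - x)) \<bullet> v)) (at 0)"
        unfolding p_def by (rule has_derivative_compose)
      then show ?thesis
        by (simp add: has_field_derivative_def inner_commute mult_commute_abs)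
    qed
    ultimately have "p 1 - p 0 \<ge> v \<bullet> (y - x) * (1 - 0)"
      by (intro convex_on_imp_above_tangent[of UNIV]) auto
    then show ?thesis by (simp add: p_def)
  qed
  then show ?thesis by (simp add: convex_subdifferential_def)
qed

text \<open>In the smooth version \<open>g\<close> may also be convex, and then
  \<open>subdifferential\<close> takes its convex branch; both branches must contain the
  gradient.\<close>

lemma grad_in_subdifferential:
  fixes g :: "real^'n \<Rightarrow> real"
  assumes "g differentiable (at x)"
  shows "grad g x \<in> subdifferential g x"
  using GDERIV_grad[OF assms] GDERIV_convex_subgradient by (auto simp: subdifferential_def)

section \<open>Passage to the limit along a run\<close>

lemma tendsto_matrix_vector_mult:
  fixes A :: "nat \<Rightarrow> real^'n^'m"
  assumes "(A \<longlongrightarrow> B) net" "(u \<longlongrightarrow> v) net"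
  shows "((\<lambda>k. A k *v u k) \<longlongrightarrow> B *v v) net"
  unfolding matrix_vector_mult_def using assms by (intro tendsto_intros)

text \<open>In the limit the base point minimizes its own regularised model; the quadratic growth of
  the latter then cancels the regularisation.\<close>

lemma limit_point_minimizes_model:
  fixes x :: "nat \<Rightarrow> real^'n"
  assumes m: "\<And>y. convex_on UNIV (m y)" and \<Omega>: "closed \<Omega>" "convex \<Omega>"
    and arg: "\<And>k. is_arg_min (reg_model m (\<rho> k) (x k)) (\<lambda>y. y \<in> \<Omega>) (x (Suc k))"
    and \<rho>: "\<And>k. 0 \<le> \<rho> k" "\<And>k. \<rho> k \<le> c" and l: "l \<in> limit_points x" "l \<in> \<Omega>"
    and steps: "(\<lambda>k. norm (x (Suc k) - x k)) \<longlonglongrightarrow> 0"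
    and cont: "\<And>s z w. s \<longlonglongrightarrow> l \<Longrightarrow> z \<longlonglongrightarrow> w \<Longrightarrow> (\<lambda>k. m (s k) (z k)) \<longlonglongrightarrow> m l w"
    and y: "y \<in> \<Omega>"
  shows "m l l \<le> m l y"
proof -
  obtain s where s: "strict_mono s" "(x \<circ> s) \<longlonglongrightarrow> l"
    using l by (auto simp: limit_points_def)
  then have xs: "(\<lambda>k. x (s k)) \<longlonglongrightarrow> l" by (simp add: o_def)
  have "(\<lambda>k. norm (x (Suc (s k)) - x (s k))) \<longlonglongrightarrow> 0"
    using LIMSEQ_subseq_LIMSEQ[OF steps s(1)] by (simp add: o_def)
  then have "(\<lambda>k. (x (Suc (s k)) - x (s k)) + x (s k)) \<longlonglongrightarrow> 0 + l"
    by (intro tendsto_add xs) (simp add: tendsto_norm_zero_iff)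
  then have xs': "(\<lambda>k. x (Suc (s k))) \<longlonglongrightarrow> l" by simp
  \<comment> \<open>The parameters \<open>\<rho> k\<close> need not converge. On the left the
    penalty is dropped, on the right \<open>\<rho> k\<close> is replaced by its bound
    \<open>c\<close>.\<close>
  have "m l l \<le> reg_model m c l z" if z: "z \<in> \<Omega>" for z
  proof (rule LIMSEQ_le)
    show "(\<lambda>k. m (x (s k)) (x (Suc (s k)))) \<longlonglongrightarrow> m l l"
      by (rule cont[OF xs xs'])
    show "(\<lambda>k. m (x (s k)) z + c / 2 * (norm (z - x (s k)))\<^sup>2) \<longlonglongrightarrow> reg_model m c l z"
      unfolding reg_model_def by (intro tendsto_intros cont xs)
    have "m (x k) (x (Suc k)) \<le> m (x k) z + c / 2 * (norm (z - x k))\<^sup>2" for k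
    proof -
      have "m (x k) (x (Suc k)) \<le> reg_model m (\<rho> k) (x k) (x (Suc k))"
        using \<rho>(1)[of k] by (simp add: reg_model_def)
      also have "\<dots> \<le> reg_model m (\<rho> k) (x k) z"
        using arg z by (simp add: is_arg_min_linorder)
      also have "\<dots> \<le> m (x k) z + c / 2 * (norm (z - x k))\<^sup>2"
        using \<rho>(2)[of k] by (auto simp: reg_model_def intro!: mult_right_mono)
      finally show ?thesis .
    qed
    then show "\<exists>N. \<forall>k\<ge>N. m (x (s k)) (x (Suc (s k)))
        \<le> m (x (s k)) z + c / 2 * (norm (z - x (s k)))\<^sup>2"
      by blast
  qed
  then have "is_arg_min (reg_model m c l) (\<lambda>y. y \<in> \<Omega>) l"
    using l by (simp add: is_arg_min_linorder) (simp add: reg_model_def)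
  from reg_model_growth[OF m \<Omega>(2) this y] show ?thesis
    by (simp add: reg_model_def)
qed

lemma algorithm_run_limit_critical:
  fixes x :: "nat \<Rightarrow> real^'n" and F :: "real^'n \<Rightarrow> real^'m"
  assumes run: "algorithm_run \<Omega> f m L0 L x \<rho>"
    and m_eq: "\<And>y z. m y z = h y z + \<phi> (F y + jacobian F (at y) *v (z - y))"
    and h: "\<And>y. convex_on UNIV (h y)" "\<And>y. h y y + \<phi> (F y) = f y"
      "\<And>y. convex_subdifferential (h y) y \<subseteq> subdifferential g y"
      "\<And>l s z w. s \<longlonglongrightarrow> l \<Longrightarrow> z \<longlonglongrightarrow> w \<Longrightarrow> (\<lambda>k::nat. h (s k) (z k)) \<longlonglongrightarrow> h l w"
    and \<phi>: "convex_on UNIV \<phi>"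
    and \<Omega>: "closed \<Omega>" "convex \<Omega>" and bdd: "bdd_below (f ` \<Omega>)"
    and F: "open U" "C1_on U F" and level: "level_set \<Omega> f (f (x 0)) \<subseteq> U"
    and closed_level: "closed (level_set \<Omega> f (f (x 0)))"
  shows "limit_points x \<subseteq> critical_points \<Omega> g \<phi> F"
proof
  fix l
  assume l: "l \<in> limit_points x"
  have m: "convex_on UNIV (m y)" for y
    unfolding m_eq[abs_def]
    by (intro convex_on_add h(1) convex_on_affine_compose \<phi> matrix_vector_mul_linear)
  have mf: "m y y = f y" for y by (simp add: m_eq h(2))
  note D = algorithm_run_descent[OF run m mf \<Omega>]
  have L0: "L0 > 0" using run by (simp add: algorithm_run_def)
  have \<rho>: "0 \<le> \<rho> k" "\<rho> k \<le> 2 * L" for k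
    using run L0 by (auto simp: algorithm_run_def intro: order_trans[of 0 L0])
  note lev = algorithm_run_in_level_set[OF run m mf \<Omega>]
  obtain s where "(x \<circ> s) \<longlonglongrightarrow> l" using l by (auto simp: limit_points_def)
  \<comment> \<open>Outside \<open>U\<close> nothing is known about \<open>F\<close>, so the limit
    is located in the level set before any continuity is used.\<close>
  then have l_lev: "l \<in> level_set \<Omega> f (f (x 0))"
    using closed_sequentially[OF closed_level, of "x \<circ> s"] lev by auto
  then have lU: "l \<in> U" and l\<Omega>: "l \<in> \<Omega>" using level by (auto simp: level_set_def)
  have diff: "F differentiable (at l)" and "continuous_on U (\<lambda>x. jacobian F (at x))"
    using F lU by (auto simp: C1_on_def)
  then have contF: "isCont F l" and contJ: "isCont (\<lambda>x. jacobian F (at x)) l"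
    using F(1) lU differentiable_imp_continuous_within continuous_on_eq_continuous_at by blast+
  have cont\<phi>: "isCont \<phi> y" for y
    using convex_on_continuous[OF open_UNIV \<phi>] by (simp add: continuous_on_eq_continuous_at)
  have "m l l \<le> m l y" if "y \<in> \<Omega>" for y
  proof (rule limit_point_minimizes_model[OF m \<Omega> D(2) \<rho> l l\<Omega> _ _ that])
    show "(\<lambda>k. norm (x (Suc k) - x k)) \<longlonglongrightarrow> 0"
      by (rule algorithm_run_summable(5)[OF run m mf \<Omega> bdd])
    show "(\<lambda>k. m (s k) (z k)) \<longlonglongrightarrow> m l w" if "s \<longlonglongrightarrow> l" "z \<longlonglongrightarrow> w" for s z w
      unfolding m_eq using that
      by (intro tendsto_add h(4) isCont_tendsto_compose[OF cont\<phi>] isCont_tendsto_compose[OF contF]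
          tendsto_matrix_vector_mult tendsto_diff isCont_tendsto_compose[OF contJ])
  qed
  then show "l \<in> critical_points \<Omega> g \<phi> F"
    by (intro critical_pointI[OF h(1) \<phi> \<Omega>(2) l\<Omega> diff _ h(3)]) (simp add: m_eq)
qed

text \<open>Closedness of the level set enters only through \<open>crit\<close>. Nonemptiness in the
  last claim excludes escape to infinity, where the set of limit points is empty and therefore
  finite.\<close>

lemma algorithm_run_asymptotics:
  fixes x :: "nat \<Rightarrow> real^'n"
  assumes run: "algorithm_run \<Omega> f m L0 L x \<rho>"
    and m: "\<And>y. convex_on UNIV (m y)" "\<And>y. m y y = f y"
    and \<Omega>: "closed \<Omega>" "convex \<Omega>" and bdd: "bdd_below (f ` \<Omega>)"
    and crit: "closed (level_set \<Omega> f (f (x 0))) \<Longrightarrow> limit_points x \<subseteq> S"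
  shows "(\<lambda>k. norm (x (Suc k) - x k)) \<longlonglongrightarrow> 0"
    and "bounded (level_set \<Omega> f (f (x 0))) \<Longrightarrow> bounded (range x)"
    and "bounded (range x) \<Longrightarrow> connected (limit_points x)"
    and "finite (limit_points x) \<Longrightarrow> limit_points x \<noteq> {} \<Longrightarrow>
      \<exists>l. x \<longlonglongrightarrow> l \<and> (closed (level_set \<Omega> f (f (x 0))) \<longrightarrow> l \<in> S)"
proof -
  show steps: "(\<lambda>k. norm (x (Suc k) - x k)) \<longlonglongrightarrow> 0"
    by (rule algorithm_run_summable(5)[OF run m \<Omega> bdd])
  note lev = algorithm_run_in_level_set[OF run m \<Omega>]
  show "bounded (range x)" if "bounded (level_set \<Omega> f (f (x 0)))"
    using lev by (intro bounded_subset[OF that]) auto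
  show "connected (limit_points x)" if "bounded (range x)"
    by (rule connected_limit_points[OF that steps])
  show "\<exists>l. x \<longlonglongrightarrow> l \<and> (closed (level_set \<Omega> f (f (x 0))) \<longrightarrow> l \<in> S)"
    if fin: "finite (limit_points x)" "limit_points x \<noteq> {}"
    using fin crit isolated_limit_point_imp_convergent[OF fin(1) _ steps] by blast
qed

text \<open>Summability is stated beside the estimates because \<open>suminf\<close> has an
  unspecified value on divergent series. Connectedness is claimed for bounded iterates: vanishing
  steps alone would let a sequence travel between limit points by way of infinity. Criticality is
  claimed for a closed initial level set.\<close>

theorem theorem3p1:
  fixes \<Omega> :: "(real^'n) set"
    and g :: "real^'n \<Rightarrow> real"
    and F :: "real^'n \<Rightarrow> real^'m"
    and \<F> :: "(real^'n) set"
    and \<phi> :: "real^'m \<Rightarrow> real"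
    and L\<phi> LF Lg L0 :: real
    and x :: "nat \<Rightarrow> real^'n"
    and \<rho> :: "nat \<Rightarrow> real"
  assumes \<Omega>: "\<Omega> \<noteq> {}" "closed \<Omega>" "convex \<Omega>"
    and F: "open \<F>" "C1_on \<F> F"
    and \<phi>: "lsc_convex \<phi>"
    and optimal_value_finite: "bdd_below (objective g \<phi> F ` \<Omega>)"
    and critical_exists: "critical_points \<Omega> g \<phi> F \<noteq> {}"
    and \<phi>_Lipschitz: "L\<phi> > 0"
      "\<forall>y\<in>\<F>. \<forall>u \<in> range ((*v) (jacobian F (at y))). \<forall>v \<in> range ((*v) (jacobian F (at y))).
         \<bar>\<phi> u - \<phi> v\<bar> \<le> L\<phi> * norm (u - v)"
    and F_Lipschitz: "\<forall>y\<in>\<F>. \<forall>z\<in>\<F>.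
         onorm ((*v) (jacobian F (at y) - jacobian F (at z))) \<le> LF * norm (z - y)"
    and level: "level_set \<Omega> (objective g \<phi> F) (objective g \<phi> F (x 0)) \<subseteq> \<F>"
  shows
    "let f = objective g \<phi> F;
         fstar = (INF y\<in>\<Omega>. f y);
         S = critical_points \<Omega> g \<phi> F;
         Q = limit_points x;
         level0 = level_set \<Omega> f (f (x 0));
         m1 = model1 g \<phi> F; Lbar = Lg + L\<phi> * LF; r1 = step_length \<Omega> m1;
         m2 = model2 g \<phi> F; Lhat = L\<phi> * LF; r2 = step_length \<Omega> m2;
         case_a = (smooth_with_constant Lg g \<and> algorithm_run \<Omega> f m1 L0 Lbar x \<rho>);
         case_b = (lsc_convex g \<and> algorithm_run \<Omega> f m2 L0 Lhat x \<rho>)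
     in
       (case_a \<longrightarrow> (\<forall>k.
          summable (\<lambda>i. (r1 (\<rho> (k + i)) (x (k + i)))\<^sup>2) \<and>
          summable (\<lambda>i. (r1 (2 * Lbar) (x (k + i)))\<^sup>2) \<and>
          f (x k) - fstar \<ge> L0 / 2 * (\<Sum>i. (r1 (\<rho> (k + i)) (x (k + i)))\<^sup>2) \<and>
          L0 / 2 * (\<Sum>i. (r1 (\<rho> (k + i)) (x (k + i)))\<^sup>2)
            \<ge> L0 / 2 * (\<Sum>i. (r1 (2 * Lbar) (x (k + i)))\<^sup>2))) \<and>
       (case_b \<longrightarrow> (\<forall>k.
          summable (\<lambda>i. (r2 (\<rho> (k + i)) (x (k + i)))\<^sup>2) \<and>
          summable (\<lambda>i. (r2 (2 * Lhat) (x (k + i)))\<^sup>2) \<and>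
          f (x k) - fstar \<ge> L0 / 2 * (\<Sum>i. (r2 (\<rho> (k + i)) (x (k + i)))\<^sup>2) \<and>
          L0 / 2 * (\<Sum>i. (r2 (\<rho> (k + i)) (x (k + i)))\<^sup>2)
            \<ge> L0 / 2 * (\<Sum>i. (r2 (2 * Lhat) (x (k + i)))\<^sup>2))) \<and>
       (case_a \<or> case_b \<longrightarrow>
          (\<lambda>k. norm (x (Suc k) - x k)) \<longlonglongrightarrow> 0 \<and>
          (bounded level0 \<longrightarrow> bounded (range x)) \<and>
          (bounded (range x) \<longrightarrow> connected Q) \<and>
          (closed level0 \<and> bounded (range x) \<longrightarrow> Q \<subseteq> S) \<and>
          (finite Q \<and> Q \<noteq> {} \<longrightarrow>
             (\<exists>xstar. x \<longlonglongrightarrow> xstar \<and> (closed level0 \<longrightarrow> xstar \<in> S))))"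
proof -
  let ?f = "objective g \<phi> F" and ?m1 = "model1 g \<phi> F" and ?m2 = "model2 g \<phi> F"
  let ?A = "smooth_with_constant Lg g \<and> algorithm_run \<Omega> ?f ?m1 L0 (Lg + L\<phi> * LF) x \<rho>"
  let ?B = "lsc_convex g \<and> algorithm_run \<Omega> ?f ?m2 L0 (L\<phi> * LF) x \<rho>"
  let ?level = "level_set \<Omega> ?f (?f (x 0))" and ?S = "critical_points \<Omega> g \<phi> F"
  have c\<phi>: "convex_on UNIV \<phi>" using \<phi> by (simp add: lsc_convex_def)
  note comp = convex_on_affine_compose[OF c\<phi> matrix_vector_mul_linear]
  have m1: "convex_on UNIV (?m1 y)" "?m1 y y = ?f y" for y
    unfolding model1_def[abs_def]
    by (intro convex_on_add convex_on_affine comp) (simp add: objective_def)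
  have m2: "convex_on UNIV (?m2 y)" "?m2 y y = ?f y" if "convex_on UNIV g" for y
    unfolding model2_def[abs_def]
    by (intro convex_on_add that comp) (simp add: objective_def)
  note bdd = optimal_value_finite
  have crit_a: "limit_points x \<subseteq> ?S" if a: ?A and cl: "closed ?level"
  proof -
    have gdiff: "g differentiable (at y)" for y
      using a by (simp add: smooth_with_constant_def)
    have gLip: "norm (grad g y - grad g z) \<le> Lg * norm (z - y)" for y z
      using a by (simp add: smooth_with_constant_def)
    have gcont: "isCont g y" for y
      using gdiff differentiable_imp_continuous_within by blast
    have "Lg > 0" using a by (simp add: smooth_with_constant_def)
    \<comment> \<open>The Lipschitz bound supplies continuity of the gradient, needed when the base
      point of the linearisation moves.\<close>
    then have "Lg-lipschitz_on UNIV (grad g)"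
      using gLip by (intro lipschitz_onI) (auto simp: dist_norm norm_minus_commute)
    then have "continuous_on UNIV (grad g)" by (rule lipschitz_on_continuous_on)
    then have dcont: "isCont (grad g) y" for y
      by (simp add: continuous_on_eq_continuous_at)
    show ?thesis
    proof (rule algorithm_run_limit_critical[OF conjunct2[OF a], where U = \<F> and
          h = "\<lambda>y z. g y + grad g y \<bullet> (z - y)"])
      show "(\<lambda>k. g (s k) + grad g (s k) \<bullet> (z k - s k)) \<longlonglongrightarrow> g l + grad g l \<bullet> (w - l)"
        if "s \<longlonglongrightarrow> l" "z \<longlonglongrightarrow> w" for l w and s z :: "nat \<Rightarrow> real^'n"
        using that by (intro tendsto_intros isCont_tendsto_compose[OF gcont]
            isCont_tendsto_compose[OF dcont])
      show "convex_subdifferential (\<lambda>z. g y + grad g y \<bullet> (z - y)) y \<subseteq> subdifferential g y" for y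
        using convex_subdifferential_affine grad_in_subdifferential[OF gdiff] by blast
    qed (use cl \<Omega> bdd F level c\<phi> convex_on_affine in \<open>simp_all add: model1_def objective_def\<close>)
  qed
  have crit_b: "limit_points x \<subseteq> ?S" if b: ?B and cl: "closed ?level"
  proof -
    have cg: "convex_on UNIV g" using b by (simp add: lsc_convex_def)
    then have gcont: "isCont g y" for y
      using convex_on_continuous[OF open_UNIV cg] by (simp add: continuous_on_eq_continuous_at)
    show ?thesis
    \<comment> \<open>Here \<open>h\<close> ignores the base point, so the inclusion of
      subdifferentials is the convex branch of the definition.\<close>
    proof (rule algorithm_run_limit_critical[OF conjunct2[OF b], where U = \<F> and
          h = "\<lambda>y z. g z"])
      show "(\<lambda>k. g (z k)) \<longlonglongrightarrow> g w" if "z \<longlonglongrightarrow> w" for w and z :: "nat \<Rightarrow> real^'n"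
        using that by (rule isCont_tendsto_compose[OF gcont])
      show "convex_subdifferential g y \<subseteq> subdifferential g y" for y
        using b by (simp add: subdifferential_def lsc_convex_def)
    qed (use cl cg \<Omega> bdd F level c\<phi> in \<open>simp_all add: model2_def objective_def\<close>)
  qed
  have concl: "(\<lambda>k. norm (x (Suc k) - x k)) \<longlonglongrightarrow> 0 \<and>
      (bounded ?level \<longrightarrow> bounded (range x)) \<and>
      (bounded (range x) \<longrightarrow> connected (limit_points x)) \<and>
      (closed ?level \<and> bounded (range x) \<longrightarrow> limit_points x \<subseteq> ?S) \<and>
      (finite (limit_points x) \<and> limit_points x \<noteq> {} \<longrightarrow>
        (\<exists>l. x \<longlonglongrightarrow> l \<and> (closed ?level \<longrightarrow> l \<in> ?S)))"
    if "?A \<or> ?B"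
    using that
  proof
    assume a: ?A
    note R = algorithm_run_asymptotics[OF conjunct2[OF a] m1 \<Omega>(2,3) bdd crit_a[OF a]]
    show ?thesis using R crit_a[OF a] by blast
  next
    assume b: ?B
    then have "convex_on UNIV g" by (simp add: lsc_convex_def)
    note R = algorithm_run_asymptotics[OF conjunct2[OF b] m2[OF this] \<Omega>(2,3) bdd crit_b[OF b]]
    show ?thesis using R crit_b[OF b] by blast
  qed
  note sum_a = algorithm_run_summable(1-4)[OF conjunct2 m1 \<Omega>(2,3) bdd]
  have sum_b: "convex_on UNIV g" if ?B
    using that by (simp add: lsc_convex_def)
  note sum_b = algorithm_run_summable(1-4)[OF conjunct2 m2[OF sum_b] \<Omega>(2,3) bdd]
  show ?thesis
    unfolding Let_def
    by (rule conjI[OF impI conjI[OF impI impI]];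
        (erule concl | intro allI conjI; (rule sum_a, assumption | rule sum_b; assumption)))
qed

end
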